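(* For every date $t$ and every history $h_t$, $$\mathfrak S_t(h_t)=\Bigl\{\bigl(P_t^r(h_t);V_{0,t}^{\pi}(h_t),\ldots,V_{t,t}^{\pi}(h_t)\bigr): r\in\mathscr R_t(h_t),\ \pi\in\mathrm{SPE}_t(r;h_t)\Bigr\}.$$ Consequently, with $\mathfrak d_t^{\rm RL,SPE}(h_t):=\sup_{(p;u_0,\ldots,u_t)\in\mathfrak S_t(h_t)}(p-u_0)$, $$\mathfrak d_t^{\rm RL,SPE}(h_t)=\sup_{r\in\mathscr R_t(h_t)}\ \sup_{\pi\in\mathrm{SPE}_t(r;h_t)}\bigl[P_t^r(h_t)-V_{0,t}^{\pi}(h_t)\bigr].$$ Hence $\mathfrak d_t^{\rm RL,SPE}(h_t)=0$ if and only if every reward system $r\in\mathscr R_t(h_t)$ and every pure SPE continuation $\pi\in\mathrm{SPE}_t(r;h_t)$ have zero relearning loss $P_t^r(h_t)-V_{0,t}^\pi(h_t)$ at $h_t$. If every datewise and terminal reward bound is multiplied by $c\ge0$, then $\mathfrak d_t^{\rm RL,SPE}(h_t)$ is multiplied by $c$.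
   Context: Finite controlled event tree: dates $t=0,\dots,T$; a finite set of histories at each date; at each $h_t$ with $t<T$ a finite nonempty action set $\mathcal A_t(h_t)$; after action $a$, an observation $y$ in a finite set $\mathcal Y_{t+1}(h_t,a)$, leading to history $(h_t,a,y)$. Discount $\beta\in(0,1]$. For $0\le s\le t<T$, $h_t$, $a$, a nonempty compact set $\mathcal K_{s,t}(h_t,a)\subseteq\Delta(\mathcal Y_{t+1}(h_t,a))$ is fixed (one-step kernels of evaluator vintage $s$ at date $t$). Reward bounds $R_t\ge0$, $G\ge0$ are fixed. $\mathscr R_t(h_t)$ is the class of all reward systems $r=(r_j,g)$ on the subtree rooted at $h_t$ with $|r_j(h_j,a)|\le R_j$ and $|g(h_T)|\le G$, rewards being independently specifiable on disjoint action–outcome subtrees. For a pure policy $\pi$ on the subtree, $V_{s,T}^\pi=g$ and, for $j<T$ and $s\le j$, $V_{s,j}^\pi(h_j)=Q_j^{s,\pi}(h_j,\pi_j(h_j))$, where $Q_j^{s,\pi}(h_j,a)=r_j(h_j,a)+\beta\inf_{q\in\mathcal K_{s,j}(h_j,a)}\sum_yq(y)V_{s,j+1}^\pi(h_j,a,y)$. $\mathrm{SPE}_t(r;h_t)$ is the set of pure policies $\pi$ on the subtree with $\pi_j(h_j)\in\arg\max_{a}Q_j^{j,\pi}(h_j,a)$ at every history $h_j$ ($j<T$) of the subtree (including off-path histories). $P_t^r(h_t)$ is the vintage-$0$ rectangular precommitment optimum: $P_T^r=g$, $P_j^r(h_j)=\max_a\{r_j(h_j,a)+\beta\inf_{q\in\mathcal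 K_{0,j}(h_j,a)}\sum_yq(y)P_{j+1}^r(h_j,a,y)\}$ (equivalently $\max_\pi V_{0,j}^\pi(h_j)$). The sets $\mathfrak S_t(h_t)\subseteq\mathbb R^{t+2}$ are defined recursively. $\mathfrak S_T(h_T)=\{(z;z,\ldots,z)\in\mathbb R^{T+2}:|z|\le G\}$. Given $\mathfrak S_{t+1}$: for each action $a\in\mathcal A_t(h_t)$ choose $c_a\in[-R_t,R_t]$ and, independently for every $y$, a vector $(p_{a,y};u_{0,a,y},\ldots,u_{t+1,a,y})\in\mathfrak S_{t+1}(h_t,a,y)$; set $P_a=c_a+\beta\inf_{q\in\mathcal K_{0,t}(h_t,a)}\sum_yq(y)p_{a,y}$ and $U_{s,a}=c_a+\beta\inf_{q\in\mathcal K_{s,t}(h_t,a)}\sum_yq(y)u_{s,a,y}$ for $0\le s\le t$. For every $a_F\in\arg\max_{a}U_{t,a}$ include the vector $(\max_aP_a;U_{0,a_F},\ldots,U_{t,a_F})$. $\mathfrak S_t(h_t)$ is the set of all vectors so obtained. *)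

theory Defs
  imports "HOL-Analysis.Analysis"
begin

section \<open>Controlled event trees\<close>

text \<open>The history \<open>Step h a y\<close> is the paper's \<open>(h, a, y)\<close>; a history determines its date.\<close>

datatype ('o, 'a, 'y) history = Initial 'o | Step "('o, 'a, 'y) history" 'a 'y

primrec hdate :: "('o, 'a, 'y) history \<Rightarrow> nat" where
  "hdate (Initial x) = 0"
| "hdate (Step h a y) = Suc (hdate h)"

text \<open>In \<open>kernels M s h a\<close> the number \<open>s\<close> is the evaluator vintage; the date is \<open>hdate h\<close>.
  \<open>reward_bound M t\<close> is used for \<open>t < horizon M\<close> only.\<close>

record ('o, 'a, 'y) event_model =
  horizon :: nat
  initials :: "'o set"
  actions :: "('o, 'a, 'y) history \<Rightarrow> 'a set"
  observations :: "('o, 'a, 'y) history \<Rightarrow> 'a \<Rightarrow> 'y set"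
  discount :: real
  kernels :: "nat \<Rightarrow> ('o, 'a, 'y) history \<Rightarrow> 'a \<Rightarrow> ('y \<Rightarrow> real) set"
  reward_bound :: "nat \<Rightarrow> real"
  terminal_bound :: real

primrec histories :: "('o, 'a, 'y) event_model \<Rightarrow> nat \<Rightarrow> ('o, 'a, 'y) history set" where
  "histories M 0 = Initial ` initials M"
| "histories M (Suc t) =
     {Step h a y | h a y. h \<in> histories M t \<and> a \<in> actions M h \<and> y \<in> observations M h a}"

text \<open>Mass functions vanish off \<open>Y\<close>, so for finite \<open>Y\<close> compactness in the product topology of
  \<open>'y \<Rightarrow> real\<close> is compactness in the Euclidean space of real vectors indexed by \<open>Y\<close>.\<close>

definition distributions :: "'y set \<Rightarrow> ('y \<Rightarrow> real) set" where
  "distributions Y = {q. (\<forall>y. 0 \<le> q y) \<and> (\<forall>y. y \<notin> Y \<longrightarrow> q y = 0) \<and> (\<Sum>y\<in>Y. q y) = 1}"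

locale event_tree =
  fixes M :: "('o, 'a, 'y) event_model"
  assumes finite_initials: "finite (initials M)"
    and actions: "\<lbrakk>t < horizon M; h \<in> histories M t\<rbrakk>
      \<Longrightarrow> finite (actions M h) \<and> actions M h \<noteq> {}"
    and observations: "\<lbrakk>t < horizon M; h \<in> histories M t; a \<in> actions M h\<rbrakk>
      \<Longrightarrow> finite (observations M h a)"
    and discount: "0 < discount M" "discount M \<le> 1"
    and kernels: "\<lbrakk>s \<le> t; t < horizon M; h \<in> histories M t; a \<in> actions M h\<rbrakk>
      \<Longrightarrow> kernels M s h a \<noteq> {} \<and> compact (kernels M s h a)
        \<and> kernels M s h a \<subseteq> distributions (observations M h a)"
    and reward_bound: "t < horizon M \<Longrightarrow> 0 \<le> reward_bound M t"
    and terminal_bound: "0 \<le> terminal_bound M"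

definition scale_bounds :: "real \<Rightarrow> ('o, 'a, 'y) event_model \<Rightarrow> ('o, 'a, 'y) event_model" where
  "scale_bounds c M =
     M\<lparr>reward_bound := (\<lambda>t. c * reward_bound M t), terminal_bound := c * terminal_bound M\<rparr>"

inductive_set subtree :: "('o, 'a, 'y) event_model \<Rightarrow> ('o, 'a, 'y) history
    \<Rightarrow> ('o, 'a, 'y) history set"
  for M h where
  root: "h \<in> subtree M h"
| step: "\<lbrakk>k \<in> subtree M h; hdate k < horizon M; a \<in> actions M k; y \<in> observations M k a\<rbrakk>
    \<Longrightarrow> Step k a y \<in> subtree M h"


section \<open>Reward systems, policies and values\<close>

text \<open>Reward systems and policies on a subtree are total functions; their values elsewhere are
  unconstrained, and no quantity evaluated on the subtree depends on them.\<close>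

record ('o, 'a, 'y) reward_system =
  flow :: "('o, 'a, 'y) history \<Rightarrow> 'a \<Rightarrow> real"
  final :: "('o, 'a, 'y) history \<Rightarrow> real"

definition reward_systems :: "('o, 'a, 'y) event_model \<Rightarrow> ('o, 'a, 'y) history
    \<Rightarrow> ('o, 'a, 'y) reward_system set" where
  "reward_systems M h = {r.
     (\<forall>k\<in>subtree M h. hdate k < horizon M \<longrightarrow>
        (\<forall>a\<in>actions M k. \<bar>flow r k a\<bar> \<le> reward_bound M (hdate k))) \<and>
     (\<forall>k\<in>subtree M h. hdate k = horizon M \<longrightarrow> \<bar>final r k\<bar> \<le> terminal_bound M)}"

type_synonym ('o, 'a, 'y) policy = "('o, 'a, 'y) history \<Rightarrow> 'a"

definition policies :: "('o, 'a, 'y) event_model \<Rightarrow> ('o, 'a, 'y) history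
    \<Rightarrow> ('o, 'a, 'y) policy set" where
  "policies M h = (\<Pi> k \<in> {k \<in> subtree M h. hdate k < horizon M}. actions M k)"

definition worst_case :: "('o, 'a, 'y) event_model \<Rightarrow> nat \<Rightarrow> ('o, 'a, 'y) history \<Rightarrow> 'a
    \<Rightarrow> ('y \<Rightarrow> real) \<Rightarrow> real" where
  "worst_case M s h a v = (INF q\<in>kernels M s h a. \<Sum>y\<in>observations M h a. q y * v y)"

text \<open>The paper's mutual recursion of \<open>V\<close> and \<open>Q\<close>, with \<open>Q\<close> inlined in the first definition.\<close>

function V :: "('o, 'a, 'y) event_model \<Rightarrow> ('o, 'a, 'y) reward_system \<Rightarrow> ('o, 'a, 'y) policy
    \<Rightarrow> nat \<Rightarrow> ('o, 'a, 'y) history \<Rightarrow> real" where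
  "V M r \<pi> s h =
     (if hdate h < horizon M
      then flow r h (\<pi> h)
        + discount M * worst_case M s h (\<pi> h) (\<lambda>y. V M r \<pi> s (Step h (\<pi> h) y))
      else final r h)"
  by pat_completeness auto
termination
  by (relation "Wellfounded.measure (\<lambda>(M, r, \<pi>, s, h). horizon M - hdate h)") auto

definition Q :: "('o, 'a, 'y) event_model \<Rightarrow> ('o, 'a, 'y) reward_system \<Rightarrow> ('o, 'a, 'y) policy
    \<Rightarrow> nat \<Rightarrow> ('o, 'a, 'y) history \<Rightarrow> 'a \<Rightarrow> real" where
  "Q M r \<pi> s h a =
     flow r h a + discount M * worst_case M s h a (\<lambda>y. V M r \<pi> s (Step h a y))"

lemma V_eq_Q: "hdate h < horizon M \<Longrightarrow> V M r \<pi> s h = Q M r \<pi> s h (\<pi> h)"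
  by (simp add: Q_def)

definition SPE :: "('o, 'a, 'y) event_model \<Rightarrow> ('o, 'a, 'y) reward_system
    \<Rightarrow> ('o, 'a, 'y) history \<Rightarrow> ('o, 'a, 'y) policy set" where
  "SPE M r h = {\<pi> \<in> policies M h. \<forall>k\<in>subtree M h. hdate k < horizon M \<longrightarrow>
     is_arg_max (Q M r \<pi> (hdate k) k) (\<lambda>a. a \<in> actions M k) (\<pi> k)}"

function precommit :: "('o, 'a, 'y) event_model \<Rightarrow> ('o, 'a, 'y) reward_system
    \<Rightarrow> ('o, 'a, 'y) history \<Rightarrow> real" where
  "precommit M r h =
     (if hdate h < horizon M
      then (MAX a\<in>actions M h.
        flow r h a + discount M * worst_case M 0 h a (\<lambda>y. precommit M r (Step h a y)))
      else final r h)"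
  by pat_completeness auto
termination
  by (relation "Wellfounded.measure (\<lambda>(M, r, h). horizon M - hdate h)") auto


section \<open>Recursive value sets\<close>

text \<open>A vector \<open>(p; u\<^sub>0, \<dots>, u\<^sub>t)\<close> is the pair of \<open>p\<close> and the list \<open>[u\<^sub>0, \<dots>, u\<^sub>t]\<close>.
  In the recursive case \<open>w a y\<close> is the vector chosen for action \<open>a\<close> and observation \<open>y\<close>.\<close>

function value_set :: "('o, 'a, 'y) event_model \<Rightarrow> ('o, 'a, 'y) history
    \<Rightarrow> (real \<times> real list) set" where
  "value_set M h =
     (if hdate h < horizon M
      then {(MAX a\<in>actions M h. P a, map (\<lambda>s. U s a\<^sub>F) [0..<Suc (hdate h)]) | P U a\<^sub>F.
        \<exists>c w.
          (\<forall>a\<in>actions M h. c a \<in> {- reward_bound M (hdate h)..reward_bound M (hdate h)}) \<and>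
          (\<forall>a\<in>actions M h. \<forall>y\<in>observations M h a. w a y \<in> value_set M (Step h a y)) \<and>
          P = (\<lambda>a. c a + discount M * worst_case M 0 h a (\<lambda>y. fst (w a y))) \<and>
          U = (\<lambda>s a. c a + discount M * worst_case M s h a (\<lambda>y. snd (w a y) ! s)) \<and>
          is_arg_max (U (hdate h)) (\<lambda>a. a \<in> actions M h) a\<^sub>F}
      else {(z, replicate (Suc (horizon M)) z) | z. \<bar>z\<bar> \<le> terminal_bound M})"
  by pat_completeness auto
termination
  by (relation "Wellfounded.measure (\<lambda>(M, h). horizon M - hdate h)") auto

declare V.simps [simp del] precommit.simps [simp del] value_set.simps [simp del]

text \<open>The real supremum is genuine: at a history of an \<open>event_tree\<close> the value set is nonempty and
  bounded, since rewards are bounded and every argmax over the finite action set is attained.\<close>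

definition relearning_gap :: "('o, 'a, 'y) event_model \<Rightarrow> ('o, 'a, 'y) history \<Rightarrow> real" where
  "relearning_gap M h = (SUP (p, u)\<in>value_set M h. p - u ! 0)"

end

theory Submission imports Defs begin

text \<open>
  The value sets are built one date at a time, and in the same way an equilibrium on a subtree
  consists of rewards and a best action at the root together with an arbitrary equilibrium on each
  child subtree: values and best-response conditions on a child subtree see only what is specified
  there (\<open>V_cong\<close>, \<open>precommit_cong\<close>), and disjoint subtrees can be
  specified independently. Hence backward induction identifies the value set at a history with the
  equilibrium value vectors. Restricting an equilibrium to the children gives the choices required
  by the recursion (\<open>equilibrium_values_in_value_set\<close>). Conversely, realisations of the
  vectors chosen for the children are grafted onto a new root (\<open>graft_policy_in_SPE\<close>,
  \<open>value_set_realised\<close>); the vintages \<open>s \<le> t\<close> evaluate one and the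
  same policy, and the sitting self \<open>s = t\<close> is the one whose optimality makes it an
  equilibrium.

  The statements on the gap are about real suprema, so they need the losses to be bounded and the
  index sets to be nonempty. Discounting by at most \<open>1\<close> bounds every value by the sum
  of the remaining reward bounds, and the worst case is monotone, so that no policy evaluated by
  vintage \<open>0\<close> beats the precommitment optimum; thus every loss is nonnegative and
  bounded (\<open>value_set_bounds\<close>). Equilibria exist for every reward system because action
  sets are finite and nonempty (\<open>SPE_nonempty\<close>). A supremum of nonnegative losses
  vanishes only if each loss does.

  For a factor \<open>c > 0\<close> multiplication by \<open>c\<close> maps value sets into the
  value sets of the scaled model, since worst cases are positively homogeneous and maximisers do not
  change; the factor \<open>1 / c\<close> goes back. For \<open>c = 0\<close> the bound on the
  values forces the gap to be \<open>0\<close>.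
\<close>


section \<open>Subtrees and backward induction\<close>

lemma hdate_histories: "h \<in> histories M t \<Longrightarrow> hdate h = t"
  by (induction t arbitrary: h) auto

text \<open>The date of a history determines the number of remaining steps, so an induction from the horizon
  down to date \<open>t\<close> reaches every history from its children.\<close>

lemma (in event_tree) backward_induct [consumes 2, case_names terminal decision]:
  assumes "h \<in> histories M t" "t \<le> horizon M"
    and terminal: "\<And>h. \<lbrakk>h \<in> histories M (horizon M); hdate h = horizon M\<rbrakk> \<Longrightarrow> P h"
    and decision: "\<And>h. \<lbrakk>h \<in> histories M (hdate h); hdate h < horizon M;
      \<And>a y. \<lbrakk>a \<in> actions M h; y \<in> observations M h a\<rbrakk> \<Longrightarrow> P (Step h a y)\<rbrakk> \<Longrightarrow> P h"
  shows "P h"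
  using assms(2,1)
proof (induction t arbitrary: h rule: inc_induct)
  case base
  then show ?case using terminal hdate_histories by blast
next
  case (step n)
  have "hdate h = n" using step.prems by (rule hdate_histories)
  show ?case
  proof (rule decision)
    show "h \<in> histories M (hdate h)" "hdate h < horizon M"
      using step \<open>hdate h = n\<close> by simp_all
    show "P (Step h a y)" if "a \<in> actions M h" "y \<in> observations M h a" for a y
      using step \<open>hdate h = n\<close> that by auto
  qed
qed

lemma hdate_subtree: "k \<in> subtree M h \<Longrightarrow> hdate h \<le> hdate k"
  by (induction rule: subtree.induct) auto

lemma subtree_trans: "\<lbrakk>k \<in> subtree M g; g \<in> subtree M h\<rbrakk> \<Longrightarrow> k \<in> subtree M h"
  by (induction rule: subtree.induct) (auto intro: subtree.step)

lemma child_in_subtree: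
  "\<lbrakk>hdate h < horizon M; a \<in> actions M h; y \<in> observations M h a\<rbrakk>
    \<Longrightarrow> Step h a y \<in> subtree M h"
  by (intro subtree.intros)

text \<open>The inductive definition of the subtree appends steps at the far end; recursive values are
  defined from the near end, which calls for this decomposition into the root and its child
  subtrees.\<close>

lemma subtree_cases:
  assumes "k \<in> subtree M h"
  obtains "k = h"
    | a y where "hdate h < horizon M" "a \<in> actions M h" "y \<in> observations M h a"
        "k \<in> subtree M (Step h a y)"
  using assms
proof (induction arbitrary: thesis rule: subtree.induct)
  case root
  then show ?case by blast
next
  case (step k a y)
  show ?case
  proof (rule step.IH)
    assume "k = h"
    then show thesis using step by (blast intro: subtree.root)
  next
    fix b z
    assume "hdate h < horizon M" "b \<in> actions M h" "z \<in> observations M h b"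
      "k \<in> subtree M (Step h b z)"
    then show thesis using step by (blast intro: subtree.step)
  qed
qed

lemma subtree_terminal: "hdate h = horizon M \<Longrightarrow> subtree M h = {h}"
  by (auto elim: subtree_cases intro: subtree.root)

lemma SPE_terminal: "hdate h = horizon M \<Longrightarrow> SPE M r h = UNIV"
  by (auto simp: SPE_def policies_def subtree_terminal)

lemma policies_subtree: "\<lbrakk>\<pi> \<in> policies M h; k \<in> subtree M h\<rbrakk> \<Longrightarrow> \<pi> \<in> policies M k"
  by (auto simp: policies_def Pi_iff intro: subtree_trans)

lemma reward_systems_subtree:
  "\<lbrakk>r \<in> reward_systems M h; k \<in> subtree M h\<rbrakk> \<Longrightarrow> r \<in> reward_systems M k"
  by (auto simp: reward_systems_def intro: subtree_trans)

lemma SPE_subtree: "\<lbrakk>\<pi> \<in> SPE M r h; k \<in> subtree M h\<rbrakk> \<Longrightarrow> \<pi> \<in> SPE M r k"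
  by (auto simp: SPE_def intro: policies_subtree subtree_trans)


section \<open>Worst-case expectations\<close>

lemma worst_case_cong:
  "(\<And>y. y \<in> observations M h a \<Longrightarrow> v y = w y) \<Longrightarrow> worst_case M s h a v = worst_case M s h a w"
  unfolding worst_case_def by (intro INF_cong refl sum.cong) simp_all

lemma expectation_ge:
  fixes b :: real
  assumes "q \<in> distributions Y" "\<And>y. y \<in> Y \<Longrightarrow> b \<le> v y"
  shows "b \<le> (\<Sum>y\<in>Y. q y * v y)"
proof -
  have "b = (\<Sum>y\<in>Y. q y * b)"
    using assms(1) by (simp add: distributions_def flip: sum_distrib_right)
  also have "\<dots> \<le> (\<Sum>y\<in>Y. q y * v y)"
    using assms by (intro sum_mono mult_left_mono) (auto simp: distributions_def)
  finally show ?thesis .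
qed

lemma expectation_le:
  fixes b :: real
  assumes "q \<in> distributions Y" "\<And>y. y \<in> Y \<Longrightarrow> v y \<le> b"
  shows "(\<Sum>y\<in>Y. q y * v y) \<le> b"
  using expectation_ge[of q Y "- b" "\<lambda>y. - v y"] assms by (simp add: sum_negf)

context event_tree
begin

text \<open>The kernels are constrained at decision nodes only, and only for vintages up to the date of
  the node.\<close>

context
  fixes s :: nat and h :: "('o, 'a, 'y) history" and a :: 'a
  assumes vintage: "s \<le> hdate h" and date: "hdate h < horizon M"
    and node: "h \<in> histories M (hdate h)" and action: "a \<in> actions M h"
begin

lemma kernels_nonempty: "kernels M s h a \<noteq> {}"
  and kernels_distributions: "q \<in> kernels M s h a \<Longrightarrow> q \<in> distributions (observations M h a)"
  using kernels[OF vintage date node action] by auto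

lemma worst_case_ge:
  "(\<And>y. y \<in> observations M h a \<Longrightarrow> b \<le> v y) \<Longrightarrow> b \<le> worst_case M s h a v"
  unfolding worst_case_def
  by (intro cINF_greatest kernels_nonempty expectation_ge kernels_distributions)

text \<open>A real infimum is a lower bound only for a set that is bounded below; here the least value of the
  integrand over the finitely many observations serves as bound.\<close>

lemma bdd_below_expectations:
  "bdd_below ((\<lambda>q. \<Sum>y\<in>observations M h a. q y * v y) ` kernels M s h a)"
proof (rule bdd_belowI2)
  fix q assume "q \<in> kernels M s h a"
  then show "Min (v ` observations M h a) \<le> (\<Sum>y\<in>observations M h a. q y * v y)"
    using observations[OF date node action]
    by (intro expectation_ge kernels_distributions) auto
qed

lemma worst_case_mono:
  assumes "\<And>y. y \<in> observations M h a \<Longrightarrow> v y \<le> w y"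
  shows "worst_case M s h a v \<le> worst_case M s h a w"
  unfolding worst_case_def
proof (rule cINF_mono[OF kernels_nonempty bdd_below_expectations])
  fix q assume "q \<in> kernels M s h a"
  then show "\<exists>q'\<in>kernels M s h a. (\<Sum>y\<in>observations M h a. q' y * v y)
      \<le> (\<Sum>y\<in>observations M h a. q y * w y)"
    using kernels_distributions[of q] assms
    by (intro bexI[of _ q] sum_mono mult_left_mono) (auto simp: distributions_def)
qed

lemma abs_worst_case_le:
  assumes "\<And>y. y \<in> observations M h a \<Longrightarrow> \<bar>v y\<bar> \<le> b"
  shows "\<bar>worst_case M s h a v\<bar> \<le> b"
proof -
  obtain q where "q \<in> kernels M s h a" using kernels_nonempty by blast
  then have "worst_case M s h a v \<le> (\<Sum>y\<in>observations M h a. q y * v y)"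
    unfolding worst_case_def by (rule cINF_lower[OF bdd_below_expectations])
  also have "\<dots> \<le> b"
    using assms abs_le_D1
    by (intro expectation_le kernels_distributions \<open>q \<in> kernels M s h a\<close>) blast
  finally have "worst_case M s h a v \<le> b" .
  moreover have "- b \<le> worst_case M s h a v"
    using assms abs_le_D2 by (intro worst_case_ge) fastforce
  ultimately show ?thesis by linarith
qed

lemma worst_case_mult_le:
  assumes "0 \<le> c"
  shows "c * worst_case M s h a v \<le> worst_case M s h a (\<lambda>y. c * v y)"
  unfolding worst_case_def
proof (rule cINF_greatest[OF kernels_nonempty])
  fix q assume "q \<in> kernels M s h a"
  then have "(INF q\<in>kernels M s h a. \<Sum>y\<in>observations M h a. q y * v y)
      \<le> (\<Sum>y\<in>observations M h a. q y * v y)"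
    by (rule cINF_lower[OF bdd_below_expectations])
  then have "c * (INF q\<in>kernels M s h a. \<Sum>y\<in>observations M h a. q y * v y)
      \<le> c * (\<Sum>y\<in>observations M h a. q y * v y)"
    using assms by (rule mult_left_mono)
  then show "c * (INF q\<in>kernels M s h a. \<Sum>y\<in>observations M h a. q y * v y)
      \<le> (\<Sum>y\<in>observations M h a. q y * (c * v y))"
    by (simp add: sum_distrib_left algebra_simps)
qed

text \<open>Bounding the infimum from below gives one inequality for every nonnegative factor; the same for
  the factor \<open>inverse c\<close> is the other inequality.\<close>

lemma worst_case_mult:
  assumes "0 < c"
  shows "worst_case M s h a (\<lambda>y. c * v y) = c * worst_case M s h a v"
proof (rule antisym)
  have "inverse c * worst_case M s h a (\<lambda>y. c * v y) \<le> worst_case M s h a v"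
    using worst_case_mult_le[of "inverse c" "\<lambda>y. c * v y"] assms by (simp add: field_simps)
  then show "worst_case M s h a (\<lambda>y. c * v y) \<le> c * worst_case M s h a v"
    using assms by (simp add: field_simps)
qed (use worst_case_mult_le assms in simp)

end

end


section \<open>Locality and grafting\<close>

lemma is_arg_max_cong:
  "(\<And>a. A a \<Longrightarrow> f a = g a) \<Longrightarrow> is_arg_max f A x \<longleftrightarrow> is_arg_max g A x"
  unfolding is_arg_max_def by auto

text \<open>Membership in \<open>policies\<close> is what keeps the play inside the subtree.\<close>

lemma V_cong:
  assumes "\<pi> \<in> policies M h"
    and "\<And>k. k \<in> subtree M h \<Longrightarrow> flow r k = flow r' k"
    and "\<And>k. k \<in> subtree M h \<Longrightarrow> final r k = final r' k"
    and "\<And>k. k \<in> subtree M h \<Longrightarrow> \<pi> k = \<pi>' k"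
  shows "V M r \<pi> s h = V M r' \<pi>' s h"
  using assms
proof (induction M r \<pi> s h rule: V.induct)
  case (1 M r \<pi> s h)
  have root: "flow r h = flow r' h" "final r h = final r' h" "\<pi> h = \<pi>' h"
    using "1.prems"(2-4)[OF subtree.root] .
  show ?case
  proof (cases "hdate h < horizon M")
    case True
    then have "\<pi> h \<in> actions M h"
      using "1.prems"(1) by (auto simp: policies_def Pi_iff intro: subtree.root)
    have "V M r \<pi> s (Step h (\<pi> h) y) = V M r' \<pi>' s (Step h (\<pi> h) y)"
      if "y \<in> observations M h (\<pi> h)" for y
    proof -
      have child: "Step h (\<pi> h) y \<in> subtree M h"
        using True \<open>\<pi> h \<in> actions M h\<close> that by (rule child_in_subtree)
      show ?thesis
        by (rule "1.IH"[OF True policies_subtree[OF "1.prems"(1) child]])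
          (use 1 child in \<open>blast intro: subtree_trans\<close>)+
    qed
    then have "worst_case M s h (\<pi> h) (\<lambda>y. V M r \<pi> s (Step h (\<pi> h) y))
        = worst_case M s h (\<pi> h) (\<lambda>y. V M r' \<pi>' s (Step h (\<pi> h) y))"
      by (rule worst_case_cong)
    then show ?thesis
      using True root by (simp add: V.simps[of M r] V.simps[of M r'])
  next
    case False
    then show ?thesis using root by (simp add: V.simps)
  qed
qed

lemma Q_cong:
  assumes "\<pi> \<in> policies M h"
    and "\<And>k. k \<in> subtree M h \<Longrightarrow> flow r k = flow r' k"
    and "\<And>k. k \<in> subtree M h \<Longrightarrow> final r k = final r' k"
    and "\<And>k. k \<in> subtree M h \<Longrightarrow> \<pi> k = \<pi>' k"
    and "hdate h < horizon M" "a \<in> actions M h"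
  shows "Q M r \<pi> s h a = Q M r' \<pi>' s h a"
proof -
  have "V M r \<pi> s (Step h a y) = V M r' \<pi>' s (Step h a y)"
    if "y \<in> observations M h a" for y
  proof -
    have child: "Step h a y \<in> subtree M h"
      using assms that by (blast intro: child_in_subtree)
    show ?thesis
      by (rule V_cong[OF policies_subtree[OF assms(1) child]])
        (use assms child in \<open>blast intro: subtree_trans\<close>)+
  qed
  then have "worst_case M s h a (\<lambda>y. V M r \<pi> s (Step h a y))
      = worst_case M s h a (\<lambda>y. V M r' \<pi>' s (Step h a y))"
    by (rule worst_case_cong)
  then show ?thesis
    using assms(2) by (simp add: Q_def subtree.root)
qed

lemma precommit_cong:
  assumes "\<And>k. k \<in> subtree M h \<Longrightarrow> flow r k = flow r' k"
    and "\<And>k. k \<in> subtree M h \<Longrightarrow> final r k = final r' k"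
  shows "precommit M r h = precommit M r' h"
  using assms
proof (induction M r h rule: precommit.induct)
  case (1 M r h)
  have root: "flow r h = flow r' h" "final r h = final r' h"
    using "1.prems"[OF subtree.root] .
  show ?case
  proof (cases "hdate h < horizon M")
    case True
    have "worst_case M 0 h a (\<lambda>y. precommit M r (Step h a y))
        = worst_case M 0 h a (\<lambda>y. precommit M r' (Step h a y))"
      if "a \<in> actions M h" for a
    proof (rule worst_case_cong)
      fix y assume "y \<in> observations M h a"
      then have child: "Step h a y \<in> subtree M h"
        using True that by (blast intro: child_in_subtree)
      show "precommit M r (Step h a y) = precommit M r' (Step h a y)"
        by (rule "1.IH"[OF True that]) (use 1 child in \<open>blast intro: subtree_trans\<close>)+
    qed
    then show ?thesis
      using True root
      by (simp add: precommit.simps[of M r] precommit.simps[of M r'] cong: image_cong)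
  next
    case False
    then show ?thesis using root by (simp add: precommit.simps)
  qed
qed

text \<open>The part of a history up to date \<open>n\<close>. Applied one date after a node \<open>h\<close>, it tells which child of
  \<open>h\<close> a given later history passes through, so rewards and policies for the children can be combined
  without choosing among subtrees.\<close>

primrec history_at :: "nat \<Rightarrow> ('o, 'a, 'y) history \<Rightarrow> ('o, 'a, 'y) history" where
  "history_at n (Initial x) = Initial x"
| "history_at n (Step k a y) = (if hdate k < n then Step k a y else history_at n k)"

lemma history_at_subtree: "k \<in> subtree M h \<Longrightarrow> history_at (hdate h) k = h"
proof (induction rule: subtree.induct)
  case root
  show ?case by (cases h) auto
next
  case (step k a y)
  then show ?case using hdate_subtree[of k M h] by simp
qed

text \<open>Grafting puts a node \<open>h\<close> with its own rewards and action on top of arbitrary data for the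
  children of \<open>h\<close>, which are given as functions of the child history.\<close>

definition graft_reward :: "('o, 'a, 'y) history \<Rightarrow> ('a \<Rightarrow> real)
    \<Rightarrow> (('o, 'a, 'y) history \<Rightarrow> ('o, 'a, 'y) reward_system) \<Rightarrow> ('o, 'a, 'y) reward_system" where
  "graft_reward h c R =
     \<lparr>flow = (\<lambda>k. if k = h then c else flow (R (history_at (Suc (hdate h)) k)) k),
      final = (\<lambda>k. final (R (history_at (Suc (hdate h)) k)) k)\<rparr>"

definition graft_policy :: "('o, 'a, 'y) history \<Rightarrow> 'a
    \<Rightarrow> (('o, 'a, 'y) history \<Rightarrow> ('o, 'a, 'y) policy) \<Rightarrow> ('o, 'a, 'y) policy" where
  "graft_policy h a \<Phi> = (\<lambda>k. if k = h then a else \<Phi> (history_at (Suc (hdate h)) k) k)"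

lemma graft_root:
  "flow (graft_reward h c R) h = c" "graft_policy h a \<Phi> h = a"
  by (simp_all add: graft_reward_def graft_policy_def)

lemma graft_child:
  assumes "k \<in> subtree M (Step h a y)"
  shows "flow (graft_reward h c R) k = flow (R (Step h a y)) k"
    and "final (graft_reward h c R) k = final (R (Step h a y)) k"
    and "graft_policy h b \<Phi> k = \<Phi> (Step h a y) k"
  using hdate_subtree[OF assms] history_at_subtree[OF assms]
  by (auto simp: graft_reward_def graft_policy_def)

text \<open>Thus grafting also covers the case in which a reward system is given on the whole tree and only
  the policy has to be assembled.\<close>

lemma graft_reward_same: "graft_reward h (flow r h) (\<lambda>_. r) = r"
  by (auto simp: graft_reward_def intro!: reward_system.equality)

lemma graft_reward_in_reward_systems:
  assumes date: "hdate h < horizon M"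
    and c: "\<And>a. a \<in> actions M h \<Longrightarrow> \<bar>c a\<bar> \<le> reward_bound M (hdate h)"
    and R: "\<And>a y. \<lbrakk>a \<in> actions M h; y \<in> observations M h a\<rbrakk>
      \<Longrightarrow> R (Step h a y) \<in> reward_systems M (Step h a y)"
  shows "graft_reward h c R \<in> reward_systems M h"
proof -
  have "(hdate k < horizon M \<longrightarrow> (\<forall>b\<in>actions M k.
        \<bar>flow (graft_reward h c R) k b\<bar> \<le> reward_bound M (hdate k)))
      \<and> (hdate k = horizon M \<longrightarrow> \<bar>final (graft_reward h c R) k\<bar> \<le> terminal_bound M)"
    if "k \<in> subtree M h" for k
    using that
  proof (cases rule: subtree_cases)
    case 1
    then show ?thesis using date c by (simp add: graft_root)
  next
    case (2 a y)
    then show ?thesis using R[of a y] by (simp add: graft_child reward_systems_def)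
  qed
  then show ?thesis by (auto simp: reward_systems_def)
qed

lemma V_graft:
  assumes "\<Phi> (Step h a y) \<in> policies M (Step h a y)"
  shows "V M (graft_reward h c R) (graft_policy h b \<Phi>) s (Step h a y)
    = V M (R (Step h a y)) (\<Phi> (Step h a y)) s (Step h a y)"
  by (rule V_cong[symmetric]) (simp_all add: assms graft_child)

lemma Q_graft:
  assumes "\<And>y. y \<in> observations M h a \<Longrightarrow> \<Phi> (Step h a y) \<in> policies M (Step h a y)"
  shows "Q M (graft_reward h c R) (graft_policy h b \<Phi>) s h a = c a + discount M *
    worst_case M s h a (\<lambda>y. V M (R (Step h a y)) (\<Phi> (Step h a y)) s (Step h a y))"
  unfolding Q_def graft_root by (simp add: V_graft assms cong: worst_case_cong)

lemma precommit_graft: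
  "precommit M (graft_reward h c R) (Step h a y) = precommit M (R (Step h a y)) (Step h a y)"
  by (rule precommit_cong) (simp_all add: graft_child)

text \<open>At the root the equilibrium condition is the given maximality. Below the root the grafted data
  agree with those of the child on the whole subtree of the node in question, so the condition is
  inherited.\<close>

lemma graft_policy_in_SPE:
  assumes date: "hdate h < horizon M"
    and \<Phi>: "\<And>a y. \<lbrakk>a \<in> actions M h; y \<in> observations M h a\<rbrakk>
      \<Longrightarrow> \<Phi> (Step h a y) \<in> SPE M (R (Step h a y)) (Step h a y)"
    and best: "is_arg_max (\<lambda>a. c a + discount M * worst_case M (hdate h) h a
        (\<lambda>y. V M (R (Step h a y)) (\<Phi> (Step h a y)) (hdate h) (Step h a y)))
      (\<lambda>a. a \<in> actions M h) b"
  shows "graft_policy h b \<Phi> \<in> SPE M (graft_reward h c R) h"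
proof -
  let ?r = "graft_reward h c R" and ?\<pi> = "graft_policy h b \<Phi>"
  have pol: "\<Phi> (Step h a y) \<in> policies M (Step h a y)"
    if "a \<in> actions M h" "y \<in> observations M h a" for a y
    using \<Phi>[OF that] by (simp add: SPE_def)
  have opt: "is_arg_max (Q M ?r ?\<pi> (hdate k) k) (\<lambda>a. a \<in> actions M k) (?\<pi> k)"
    if "k \<in> subtree M h" "hdate k < horizon M" for k
    using that(1)
  proof (cases rule: subtree_cases)
    case 1
    have "is_arg_max (Q M ?r ?\<pi> (hdate h) h) (\<lambda>a. a \<in> actions M h) b"
      by (subst is_arg_max_cong[OF Q_graft]) (auto intro: pol best)
    then show ?thesis using 1 by (simp add: graft_root)
  next
    case (2 a y)
    let ?g = "Step h a y"
    have "\<Phi> ?g \<in> policies M k" using pol 2 by (blast intro: policies_subtree)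
    then have "Q M (R ?g) (\<Phi> ?g) (hdate k) k x = Q M ?r ?\<pi> (hdate k) k x"
      if "x \<in> actions M k" for x
      using that \<open>hdate k < horizon M\<close>
      by (intro Q_cong) (simp_all add: graft_child[OF subtree_trans[OF _ 2(4)]])
    moreover have "is_arg_max (Q M (R ?g) (\<Phi> ?g) (hdate k) k) (\<lambda>a. a \<in> actions M k) (\<Phi> ?g k)"
      using \<Phi>[OF 2(2,3)] 2(4) \<open>hdate k < horizon M\<close> by (simp add: SPE_def)
    ultimately show ?thesis
      unfolding graft_child(3)[OF 2(4)] by (simp cong: is_arg_max_cong)
  qed
  then have "?\<pi> \<in> policies M h"
    by (auto simp: policies_def is_arg_max_def)
  with opt show ?thesis by (simp add: SPE_def)
qed


section \<open>Value sets are the equilibrium values\<close>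

lemma value_set_terminal:
  "hdate h = horizon M \<Longrightarrow>
    value_set M h = {(z, replicate (Suc (horizon M)) z) | z. \<bar>z\<bar> \<le> terminal_bound M}"
  by (simp add: value_set.simps)

text \<open>This rule and the next replace the set comprehension in the recursion, with the functions \<open>P\<close> and \<open>U\<close>
  substituted.\<close>

lemma value_set_decisionI:
  assumes "hdate h < horizon M"
    and "\<And>a. a \<in> actions M h \<Longrightarrow> \<bar>c a\<bar> \<le> reward_bound M (hdate h)"
    and "\<And>a y. \<lbrakk>a \<in> actions M h; y \<in> observations M h a\<rbrakk> \<Longrightarrow> w a y \<in> value_set M (Step h a y)"
    and "is_arg_max (\<lambda>a. c a + discount M * worst_case M (hdate h) h a (\<lambda>y. snd (w a y) ! hdate h))
      (\<lambda>a. a \<in> actions M h) b"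
    and "p = (MAX a\<in>actions M h. c a + discount M * worst_case M 0 h a (\<lambda>y. fst (w a y)))"
    and "u = map (\<lambda>s. c b + discount M * worst_case M s h b (\<lambda>y. snd (w b y) ! s))
      [0..<Suc (hdate h)]"
  shows "(p, u) \<in> value_set M h"
  unfolding value_set.simps[of M h] assms(5,6)
  apply (simp only: assms(1) if_True mem_Collect_eq)
  apply (rule exI[of _ "\<lambda>a. c a + discount M * worst_case M 0 h a (\<lambda>y. fst (w a y))"])
  apply (rule exI[of _ "\<lambda>s a. c a + discount M * worst_case M s h a (\<lambda>y. snd (w a y) ! s)"])
  apply (rule exI[of _ b])
  apply (intro conjI refl exI[of _ c] exI[of _ w])
  using assms(2-4) by (auto simp: abs_le_iff minus_le_iff)

lemma value_set_decisionE:
  assumes "v \<in> value_set M h" "hdate h < horizon M"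
  obtains c w b where
    "\<And>a. a \<in> actions M h \<Longrightarrow> \<bar>c a\<bar> \<le> reward_bound M (hdate h)"
    "\<And>a y. \<lbrakk>a \<in> actions M h; y \<in> observations M h a\<rbrakk> \<Longrightarrow> w a y \<in> value_set M (Step h a y)"
    "is_arg_max (\<lambda>a. c a + discount M * worst_case M (hdate h) h a (\<lambda>y. snd (w a y) ! hdate h))
      (\<lambda>a. a \<in> actions M h) b"
    "v = (MAX a\<in>actions M h. c a + discount M * worst_case M 0 h a (\<lambda>y. fst (w a y)),
      map (\<lambda>s. c b + discount M * worst_case M s h b (\<lambda>y. snd (w b y) ! s)) [0..<Suc (hdate h)])"
proof -
  from assms obtain P U b c w where
    "v = (MAX a\<in>actions M h. P a, map (\<lambda>s. U s b) [0..<Suc (hdate h)])"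
    "\<forall>a\<in>actions M h. c a \<in> {- reward_bound M (hdate h)..reward_bound M (hdate h)}"
    "\<forall>a\<in>actions M h. \<forall>y\<in>observations M h a. w a y \<in> value_set M (Step h a y)"
    "P = (\<lambda>a. c a + discount M * worst_case M 0 h a (\<lambda>y. fst (w a y)))"
    "U = (\<lambda>s a. c a + discount M * worst_case M s h a (\<lambda>y. snd (w a y) ! s))"
    "is_arg_max (U (hdate h)) (\<lambda>a. a \<in> actions M h) b"
    by (subst (asm) value_set.simps) (simp only: if_True mem_Collect_eq, blast)
  then show ?thesis
    by (intro that[of c w b]) (auto simp: abs_le_iff minus_le_iff)
qed

context event_tree
begin

text \<open>The witnesses in the recursion are the root rewards and the value vectors of the restrictions to
  the children, which are again equilibria.\<close>

lemma equilibrium_values_in_value_set: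
  assumes "h \<in> histories M t" "t \<le> horizon M"
    and "r \<in> reward_systems M h" "\<pi> \<in> SPE M r h"
  shows "(precommit M r h, map (\<lambda>s. V M r \<pi> s h) [0..<Suc (hdate h)]) \<in> value_set M h"
  using assms
proof (induction rule: backward_induct)
  case (terminal h)
  then have "\<bar>final r h\<bar> \<le> terminal_bound M"
    by (auto simp: reward_systems_def intro: subtree.root)
  then show ?case
    using terminal by (simp add: value_set_terminal precommit.simps V.simps map_replicate_const
        del: upt_Suc replicate_Suc)
next
  case (decision h)
  let ?w = "\<lambda>a y. (precommit M r (Step h a y),
    map (\<lambda>s. V M r \<pi> s (Step h a y)) [0..<Suc (hdate (Step h a y))])"
  have w: "snd (?w a y) ! s = V M r \<pi> s (Step h a y)" if "s \<le> hdate h" for s a y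
    using that by (simp del: upt_Suc)
  have children: "?w a y \<in> value_set M (Step h a y)"
    if "a \<in> actions M h" "y \<in> observations M h a" for a y
    using decision that child_in_subtree[OF decision(2) that]
    by (intro decision.IH) (blast intro: reward_systems_subtree SPE_subtree)+
  have bounds: "\<bar>flow r h a\<bar> \<le> reward_bound M (hdate h)" if "a \<in> actions M h" for a
    using decision that by (auto simp: reward_systems_def intro: subtree.root)
  have best: "is_arg_max (Q M r \<pi> (hdate h) h) (\<lambda>a. a \<in> actions M h) (\<pi> h)"
    using decision by (auto simp: SPE_def intro: subtree.root)
  show ?case
  proof (rule value_set_decisionI[where c = "flow r h" and w = ?w and b = "\<pi> h"])
    show "is_arg_max (\<lambda>a. flow r h a + discount M *
        worst_case M (hdate h) h a (\<lambda>y. snd (?w a y) ! hdate h)) (\<lambda>a. a \<in> actions M h) (\<pi> h)"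
      using best unfolding w[OF order_refl] Q_def[abs_def] .
    show "precommit M r h = (MAX a\<in>actions M h.
        flow r h a + discount M * worst_case M 0 h a (\<lambda>y. fst (?w a y)))"
      using decision(2) by (simp add: precommit.simps[of M r h])
    show "map (\<lambda>s. V M r \<pi> s h) [0..<Suc (hdate h)] = map (\<lambda>s. flow r h (\<pi> h) + discount M *
        worst_case M s h (\<pi> h) (\<lambda>y. snd (?w (\<pi> h) y) ! s)) [0..<Suc (hdate h)]"
    proof (rule map_cong[OF refl])
      fix s assume "s \<in> set [0..<Suc (hdate h)]"
      then have "s \<le> hdate h" by auto
      then show "V M r \<pi> s h = flow r h (\<pi> h) + discount M *
          worst_case M s h (\<pi> h) (\<lambda>y. snd (?w (\<pi> h) y) ! s)"
        unfolding w[OF \<open>s \<le> hdate h\<close>] using decision(2) by (simp add: V_eq_Q Q_def)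
    qed
  qed (use decision(2) bounds children in auto)
qed

text \<open>The children's vectors are realised by induction, independently of each other; their
  realisations are grafted onto the root with rewards \<open>c\<close> and the maximising action \<open>b\<close>.\<close>

lemma value_set_realised:
  assumes "h \<in> histories M t" "t \<le> horizon M" "v \<in> value_set M h"
  shows "\<exists>r\<in>reward_systems M h. \<exists>\<pi>\<in>SPE M r h.
    v = (precommit M r h, map (\<lambda>s. V M r \<pi> s h) [0..<Suc (hdate h)])"
  using assms
proof (induction arbitrary: v rule: backward_induct)
  case (terminal h)
  then obtain z where z: "v = (z, replicate (Suc (horizon M)) z)" "\<bar>z\<bar> \<le> terminal_bound M"
    by (auto simp: value_set_terminal)
  define r :: "('o, 'a, 'y) reward_system" where "r = \<lparr>flow = \<lambda>_ _. 0, final = \<lambda>_. z\<rparr>"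
  have "r \<in> reward_systems M h"
    using z terminal by (simp add: reward_systems_def r_def subtree_terminal)
  \<comment> \<open>At a terminal history no action is taken, so any function is an equilibrium.\<close>
  moreover have "undefined \<in> SPE M r h"
    using terminal by (simp add: SPE_terminal)
  moreover have "v = (precommit M r h, map (\<lambda>s. V M r undefined s h) [0..<Suc (hdate h)])"
    using z terminal
    by (simp add: precommit.simps V.simps map_replicate_const r_def del: upt_Suc replicate_Suc)
  ultimately show ?case by blast
next
  case (decision h)
  obtain c w b where c: "\<And>a. a \<in> actions M h \<Longrightarrow> \<bar>c a\<bar> \<le> reward_bound M (hdate h)"
    and w: "\<And>a y. \<lbrakk>a \<in> actions M h; y \<in> observations M h a\<rbrakk>
      \<Longrightarrow> w a y \<in> value_set M (Step h a y)"
    and b: "is_arg_max (\<lambda>a. c a + discount M *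
        worst_case M (hdate h) h a (\<lambda>y. snd (w a y) ! hdate h)) (\<lambda>a. a \<in> actions M h) b"
    and v: "v = (MAX a\<in>actions M h. c a + discount M * worst_case M 0 h a (\<lambda>y. fst (w a y)),
      map (\<lambda>s. c b + discount M * worst_case M s h b (\<lambda>y. snd (w b y) ! s)) [0..<Suc (hdate h)])"
    using decision.prems decision(2) by (rule value_set_decisionE) (rule that)
  \<comment> \<open>The realisations are indexed by the child history, the form that grafting takes.\<close>
  have "\<exists>r \<pi>. \<forall>a\<in>actions M h. \<forall>y\<in>observations M h a. g = Step h a y \<longrightarrow>
      r \<in> reward_systems M g \<and> \<pi> \<in> SPE M r g \<and>
      w a y = (precommit M r g, map (\<lambda>s. V M r \<pi> s g) [0..<Suc (hdate g)])" for g
    using decision.IH w by (cases g) (blast | simp)+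
  then obtain R \<Phi> where "\<forall>g. \<forall>a\<in>actions M h. \<forall>y\<in>observations M h a. g = Step h a y \<longrightarrow>
      R g \<in> reward_systems M g \<and> \<Phi> g \<in> SPE M (R g) g \<and>
      w a y = (precommit M (R g) g, map (\<lambda>s. V M (R g) (\<Phi> g) s g) [0..<Suc (hdate g)])"
    by metis
  then have R: "R (Step h a y) \<in> reward_systems M (Step h a y)"
    and \<Phi>: "\<Phi> (Step h a y) \<in> SPE M (R (Step h a y)) (Step h a y)"
    and w_eq: "w a y = (precommit M (R (Step h a y)) (Step h a y),
      map (\<lambda>s. V M (R (Step h a y)) (\<Phi> (Step h a y)) s (Step h a y)) [0..<Suc (Suc (hdate h))])"
    if "a \<in> actions M h" "y \<in> observations M h a" for a y
    using that by auto
  have pol: "\<Phi> (Step h a y) \<in> policies M (Step h a y)"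
    if "a \<in> actions M h" "y \<in> observations M h a" for a y
    using \<Phi>[OF that] by (simp add: SPE_def)
  let ?r = "graft_reward h c R" and ?\<pi> = "graft_policy h b \<Phi>"
  have wV: "worst_case M s h a (\<lambda>y. snd (w a y) ! s) = worst_case M s h a
      (\<lambda>y. V M (R (Step h a y)) (\<Phi> (Step h a y)) s (Step h a y))"
    if "a \<in> actions M h" "s \<le> hdate h" for s a
    using that by (intro worst_case_cong) (simp add: w_eq del: upt_Suc)
  have wP: "worst_case M 0 h a (\<lambda>y. fst (w a y))
      = worst_case M 0 h a (\<lambda>y. precommit M ?r (Step h a y))" if "a \<in> actions M h" for a
    using that by (intro worst_case_cong) (simp add: w_eq precommit_graft)
  have "b \<in> actions M h" using b by (simp add: is_arg_max_def)
  have "?r \<in> reward_systems M h"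
    using decision(2) c R by (rule graft_reward_in_reward_systems)
  moreover have "?\<pi> \<in> SPE M ?r h"
    using decision(2) \<Phi>
  proof (rule graft_policy_in_SPE)
    show "is_arg_max (\<lambda>a. c a + discount M * worst_case M (hdate h) h a
        (\<lambda>y. V M (R (Step h a y)) (\<Phi> (Step h a y)) (hdate h) (Step h a y)))
        (\<lambda>a. a \<in> actions M h) b"
      using b by (subst is_arg_max_cong) (auto simp: wV)
  qed
  moreover have "precommit M ?r h = fst v"
    using decision(2) by (simp add: precommit.simps[of M ?r h] v graft_root wP cong: image_cong)
  moreover have "map (\<lambda>s. V M ?r ?\<pi> s h) [0..<Suc (hdate h)] = snd v"
    using \<open>b \<in> actions M h\<close> decision(2)
    by (auto simp: v V_eq_Q graft_root Q_graft pol wV simp del: upt_Suc)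
  ultimately show ?case by (metis prod.collapse)
qed

lemma value_set_eq:
  assumes "h \<in> histories M t" "t \<le> horizon M"
  shows "value_set M h = {(precommit M r h, map (\<lambda>s. V M r \<pi> s h) [0..<Suc t]) | r \<pi>.
    r \<in> reward_systems M h \<and> \<pi> \<in> SPE M r h}"
  using value_set_realised[OF assms] equilibrium_values_in_value_set[OF assms]
  unfolding hdate_histories[OF assms(1)] by blast

text \<open>Backward induction: at each node, a best action of the sitting self against equilibria on the
  children.\<close>

lemma SPE_nonempty:
  assumes "h \<in> histories M t" "t \<le> horizon M"
  shows "SPE M r h \<noteq> {}"
  using assms
proof (induction rule: backward_induct)
  case (terminal h)
  then show ?case by (simp add: SPE_terminal)
next
  case (decision h)
  define \<Phi> where "\<Phi> g = (SOME \<pi>. \<pi> \<in> SPE M r g)" for g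
  have \<Phi>: "\<Phi> (Step h a y) \<in> SPE M r (Step h a y)"
    if "a \<in> actions M h" "y \<in> observations M h a" for a y
    using decision.IH[OF that] unfolding \<Phi>_def by (simp add: some_in_eq)
  let ?U = "\<lambda>a. flow r h a + discount M * worst_case M (hdate h) h a
    (\<lambda>y. V M r (\<Phi> (Step h a y)) (hdate h) (Step h a y))"
  have "finite (actions M h)" "actions M h \<noteq> {}"
    using actions decision by auto
  then have "Max (?U ` actions M h) \<in> ?U ` actions M h" by (intro Max_in) auto
  then obtain b where b: "b \<in> actions M h" "Max (?U ` actions M h) = ?U b" by blast
  have "?U a \<le> ?U b" if "a \<in> actions M h" for a
    unfolding b(2)[symmetric] using \<open>finite (actions M h)\<close> that by (intro Max_ge) auto
  then have "is_arg_max ?U (\<lambda>a. a \<in> actions M h) b"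
    using b(1) by (auto simp: is_arg_max_linorder)
  then have "graft_policy h b \<Phi> \<in> SPE M (graft_reward h (flow r h) (\<lambda>_. r)) h"
    using decision(2) \<Phi> by (intro graft_policy_in_SPE) auto
  then show ?case by (auto simp: graft_reward_same)
qed

lemma reward_systems_nonempty: "reward_systems M h \<noteq> {}"
proof -
  have "\<lparr>flow = \<lambda>_ _. 0, final = \<lambda>_. 0\<rparr> \<in> reward_systems M h"
    using reward_bound terminal_bound by (auto simp: reward_systems_def)
  then show ?thesis by blast
qed

lemma value_set_nonempty:
  assumes "h \<in> histories M t" "t \<le> horizon M"
  shows "value_set M h \<noteq> {}"
  using reward_systems_nonempty[of h] SPE_nonempty[OF assms] equilibrium_values_in_value_set[OF assms]
  by blast

end


section \<open>Bounds on the loss\<close>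

definition value_bound :: "('o, 'a, 'y) event_model \<Rightarrow> nat \<Rightarrow> real" where
  "value_bound M t = (\<Sum>j=t..<horizon M. reward_bound M j) + terminal_bound M"

context event_tree
begin

text \<open>One induction for three facts: the worst case stays within the bound of its integrand and the
  discount factor is at most \<open>1\<close>, which gives the bounds; the vintage-\<open>0\<close> value of the chosen action
  is at most the precommitment value of the same action, hence at most the maximum.\<close>

lemma value_set_bounds:
  assumes "h \<in> histories M t" "t \<le> horizon M" "(p, u) \<in> value_set M h"
  shows "\<bar>p\<bar> \<le> value_bound M (hdate h) \<and> (\<forall>s\<le>hdate h. \<bar>u ! s\<bar> \<le> value_bound M (hdate h)) \<and> u ! 0 \<le> p"
  using assms
proof (induction arbitrary: p u rule: backward_induct)
  case (terminal h)
  then show ?case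
    by (auto simp: value_set_terminal value_bound_def simp del: replicate_Suc)
next
  case (decision h)
  let ?B = "value_bound M (hdate h)" and ?B' = "value_bound M (Suc (hdate h))"
  obtain c w b where c: "\<And>a. a \<in> actions M h \<Longrightarrow> \<bar>c a\<bar> \<le> reward_bound M (hdate h)"
    and w: "\<And>a y. \<lbrakk>a \<in> actions M h; y \<in> observations M h a\<rbrakk>
      \<Longrightarrow> w a y \<in> value_set M (Step h a y)"
    and b: "is_arg_max (\<lambda>a. c a + discount M *
        worst_case M (hdate h) h a (\<lambda>y. snd (w a y) ! hdate h)) (\<lambda>a. a \<in> actions M h) b"
    and v: "(p, u) = (MAX a\<in>actions M h. c a + discount M * worst_case M 0 h a (\<lambda>y. fst (w a y)),
      map (\<lambda>s. c b + discount M * worst_case M s h b (\<lambda>y. snd (w b y) ! s)) [0..<Suc (hdate h)])"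
    using decision.prems decision(2) by (rule value_set_decisionE) (rule that)
  let ?P = "\<lambda>a. c a + discount M * worst_case M 0 h a (\<lambda>y. fst (w a y))"
  have b_in: "b \<in> actions M h" using b by (simp add: is_arg_max_def)
  have fin: "finite (actions M h)" using actions decision by auto
  have p: "p = Max (?P ` actions M h)" using v by simp
  have u: "u ! s = c b + discount M * worst_case M s h b (\<lambda>y. snd (w b y) ! s)"
    if "s \<le> hdate h" for s
    using v that by (simp del: upt_Suc)
  have B: "?B = reward_bound M (hdate h) + ?B'"
    using decision(2) by (simp add: value_bound_def sum.atLeast_Suc_lessThan)
  have IH: "\<bar>fst (w a y)\<bar> \<le> ?B'" "\<And>s. s \<le> Suc (hdate h) \<Longrightarrow> \<bar>snd (w a y) ! s\<bar> \<le> ?B'"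
    "snd (w a y) ! 0 \<le> fst (w a y)"
    if "a \<in> actions M h" "y \<in> observations M h a" for a y
    using decision.IH[OF that, of "fst (w a y)" "snd (w a y)"] w[OF that] by auto
  have bound: "\<bar>c a + discount M * worst_case M s h a x\<bar> \<le> ?B"
    if "a \<in> actions M h" "s \<le> hdate h" "\<And>y. y \<in> observations M h a \<Longrightarrow> \<bar>x y\<bar> \<le> ?B'" for a s x
  proof -
    have "\<bar>worst_case M s h a x\<bar> \<le> ?B'"
      using abs_worst_case_le[OF that(2) decision(2,1) that(1) that(3)] .
    then have "discount M * \<bar>worst_case M s h a x\<bar> \<le> ?B'"
      using discount mult_left_le_one_le[of "\<bar>worst_case M s h a x\<bar>" "discount M"] by linarith
    then have "\<bar>discount M * worst_case M s h a x\<bar> \<le> ?B'"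
      using discount by (simp add: abs_mult)
    then show ?thesis using c[OF that(1)] B by linarith
  qed
  have "p \<in> ?P ` actions M h" unfolding p using fin b_in by (intro Max_in) auto
  then have "\<bar>p\<bar> \<le> ?B" using bound[where s = 0] IH(1) by auto
  moreover have "\<bar>u ! s\<bar> \<le> ?B" if "s \<le> hdate h" for s
    unfolding u[OF that] using IH(2) that b_in by (intro bound) auto
  moreover have "u ! 0 \<le> ?P b"
    using worst_case_mono[OF _ decision(2,1) b_in, of 0] IH(3)[OF b_in] discount
    by (simp add: u)
  moreover have "?P b \<le> p" unfolding p using fin b_in by (intro Max_ge) auto
  ultimately show ?case by auto
qed

lemma value_set_losses:
  assumes "h \<in> histories M t" "t \<le> horizon M"
  shows "(\<lambda>(p, u). p - u ! 0) ` value_set M h \<subseteq> {0..2 * value_bound M (hdate h)}"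
proof -
  have "p - u ! 0 \<in> {0..2 * value_bound M (hdate h)}" if "(p, u) \<in> value_set M h" for p u
    using value_set_bounds[OF assms that] by (auto simp: abs_le_iff)
  then show ?thesis by auto
qed

lemma bdd_above_losses:
  assumes "h \<in> histories M t" "t \<le> horizon M"
  shows "bdd_above ((\<lambda>(p, u). p - u ! 0) ` value_set M h)"
  using value_set_losses[OF assms] by (rule bdd_above_mono[OF bdd_above_Icc])

end


section \<open>Scaling the reward bounds\<close>

lemma scale_bounds_simps [simp]:
  "horizon (scale_bounds c M) = horizon M"
  "actions (scale_bounds c M) = actions M"
  "observations (scale_bounds c M) = observations M"
  "discount (scale_bounds c M) = discount M"
  "initials (scale_bounds c M) = initials M"
  "kernels (scale_bounds c M) = kernels M"
  "reward_bound (scale_bounds c M) = (\<lambda>t. c * reward_bound M t)"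
  "terminal_bound (scale_bounds c M) = c * terminal_bound M"
  by (simp_all add: scale_bounds_def)

lemma worst_case_scale_bounds [simp]: "worst_case (scale_bounds c M) = worst_case M"
  by (simp add: fun_eq_iff worst_case_def)

lemma histories_scale_bounds [simp]: "histories (scale_bounds c M) t = histories M t"
  by (induction t) auto

lemma scale_bounds_inverse: "c \<noteq> 0 \<Longrightarrow> scale_bounds (inverse c) (scale_bounds c M) = M"
  by (simp add: scale_bounds_def flip: mult.assoc)

lemma value_bound_scale_bounds: "value_bound (scale_bounds c M) t = c * value_bound M t"
  by (simp add: value_bound_def sum_distrib_left distrib_left)

context event_tree
begin

lemma event_tree_scale_bounds: "0 \<le> c \<Longrightarrow> event_tree (scale_bounds c M)"
  using finite_initials actions observations discount kernels reward_bound terminal_bound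
  by unfold_locales auto

lemma length_value_set:
  "\<lbrakk>(p, u) \<in> value_set M h; hdate h \<le> horizon M\<rbrakk> \<Longrightarrow> length u = Suc (hdate h)"
  by (subst (asm) value_set.simps) (auto split: if_splits)

text \<open>All the choices in the recursion are multiplied by \<open>c\<close>; this leaves the maximisers as
  they are because the worst case is positively homogeneous.\<close>

lemma scaled_value_set:
  assumes "h \<in> histories M t" "t \<le> horizon M" "0 < c" "(p, u) \<in> value_set M h"
  shows "(c * p, map ((*) c) u) \<in> value_set (scale_bounds c M) h"
  using assms
proof (induction arbitrary: p u rule: backward_induct)
  case (terminal h)
  then show ?case
    by (auto simp: value_set_terminal abs_mult simp del: replicate_Suc)
next
  case (decision h)
  obtain f w b where f: "\<And>a. a \<in> actions M h \<Longrightarrow> \<bar>f a\<bar> \<le> reward_bound M (hdate h)"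
    and w: "\<And>a y. \<lbrakk>a \<in> actions M h; y \<in> observations M h a\<rbrakk>
      \<Longrightarrow> w a y \<in> value_set M (Step h a y)"
    and b: "is_arg_max (\<lambda>a. f a + discount M *
        worst_case M (hdate h) h a (\<lambda>y. snd (w a y) ! hdate h)) (\<lambda>a. a \<in> actions M h) b"
    and v: "(p, u) = (MAX a\<in>actions M h. f a + discount M * worst_case M 0 h a (\<lambda>y. fst (w a y)),
      map (\<lambda>s. f b + discount M * worst_case M s h b (\<lambda>y. snd (w b y) ! s)) [0..<Suc (hdate h)])"
    using decision.prems(2) decision(2) by (rule value_set_decisionE) (rule that)
  let ?w = "\<lambda>a y. (c * fst (w a y), map ((*) c) (snd (w a y)))"
  have len: "hdate h < length (snd (w a y))"
    if "a \<in> actions M h" "y \<in> observations M h a" for a y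
    using length_value_set[of "fst (w a y)" "snd (w a y)"] w[OF that] decision(2) by auto
  have scaled: "c * f a + discount M * worst_case M s h a (\<lambda>y. snd (?w a y) ! s)
      = c * (f a + discount M * worst_case M s h a (\<lambda>y. snd (w a y) ! s))"
    if "a \<in> actions M h" "s \<le> hdate h" for a s
  proof -
    have "worst_case M s h a (\<lambda>y. snd (?w a y) ! s)
        = worst_case M s h a (\<lambda>y. c * snd (w a y) ! s)"
      using len that by (intro worst_case_cong) (auto intro: nth_map le_less_trans)
    then show ?thesis
      using worst_case_mult[OF that(2) decision(2,1) that(1) \<open>0 < c\<close>] by (simp add: algebra_simps)
  qed
  have scaled': "c * f a + discount M * worst_case M 0 h a (\<lambda>y. fst (?w a y))
      = c * (f a + discount M * worst_case M 0 h a (\<lambda>y. fst (w a y)))"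
    if "a \<in> actions M h" for a
    using worst_case_mult[OF _ decision(2,1) that \<open>0 < c\<close>, of 0] by (simp add: algebra_simps)
  have b_in: "b \<in> actions M h" using b by (simp add: is_arg_max_def)
  show ?case
  proof (rule value_set_decisionI[where c = "\<lambda>a. c * f a" and w = ?w and b = b])
    show "\<bar>c * f a\<bar> \<le> reward_bound (scale_bounds c M) (hdate h)"
      if "a \<in> actions (scale_bounds c M) h" for a
      using f that \<open>0 < c\<close> by (simp add: abs_mult)
    show "?w a y \<in> value_set (scale_bounds c M) (Step h a y)"
      if "a \<in> actions (scale_bounds c M) h" "y \<in> observations (scale_bounds c M) h a" for a y
      using decision.IH[of a y "fst (w a y)" "snd (w a y)"] w that \<open>0 < c\<close> by simp
    show "is_arg_max (\<lambda>a. c * f a + discount (scale_bounds c M) *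
        worst_case (scale_bounds c M) (hdate h) h a (\<lambda>y. snd (?w a y) ! hdate h))
        (\<lambda>a. a \<in> actions (scale_bounds c M) h) b"
      using b \<open>0 < c\<close> unfolding worst_case_scale_bounds scale_bounds_simps
      by (subst is_arg_max_cong[OF scaled]) (auto simp: is_arg_max_def)
    have "(MAX a\<in>actions M h. c * f a + discount M * worst_case M 0 h a (\<lambda>y. fst (?w a y)))
        = (MAX a\<in>actions M h. c * (f a + discount M * worst_case M 0 h a (\<lambda>y. fst (w a y))))"
      using scaled' by (intro arg_cong[where f = Max] image_cong) auto
    also have "\<dots> = c * (MAX a\<in>actions M h. f a + discount M * worst_case M 0 h a (\<lambda>y. fst (w a y)))"
      using mono_Max_commute[of "(*) c"
          "(\<lambda>a. f a + discount M * worst_case M 0 h a (\<lambda>y. fst (w a y))) ` actions M h"]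
        actions decision(1,2) \<open>0 < c\<close> by (auto simp: image_image mono_def)
    finally show "c * p = (MAX a\<in>actions (scale_bounds c M) h. c * f a + discount (scale_bounds c M) *
        worst_case (scale_bounds c M) 0 h a (\<lambda>y. fst (?w a y)))"
      using v by simp
    show "map ((*) c) u = map (\<lambda>s. c * f b + discount (scale_bounds c M) *
        worst_case (scale_bounds c M) s h b (\<lambda>y. snd (?w b y) ! s)) [0..<Suc (hdate h)]"
      using v scaled[OF b_in] unfolding worst_case_scale_bounds scale_bounds_simps
      by (auto simp del: upt_Suc)
  qed (use decision(2) in simp)
qed

lemma relearning_gap_scale_bounds_ge:
  assumes "h \<in> histories M t" "t \<le> horizon M" "0 < c"
  shows "c * relearning_gap M h \<le> relearning_gap (scale_bounds c M) h"
proof -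
  have "p - u ! 0 \<le> relearning_gap (scale_bounds c M) h / c" if "(p, u) \<in> value_set M h" for p u
  proof -
    have "hdate h \<le> horizon M" using assms hdate_histories by auto
    then have "length u = Suc (hdate h)" by (rule length_value_set[OF that])
    then have "c * (p - u ! 0) = (\<lambda>(p, u). p - u ! 0) (c * p, map ((*) c) u)"
      by (simp add: algebra_simps)
    also have "\<dots> \<le> relearning_gap (scale_bounds c M) h"
      unfolding relearning_gap_def
      using assms event_tree.bdd_above_losses[OF event_tree_scale_bounds, of c h t]
      by (intro cSUP_upper scaled_value_set[OF _ _ _ that]) auto
    finally show ?thesis using \<open>0 < c\<close> by (simp add: field_simps)
  qed
  then have "relearning_gap M h \<le> relearning_gap (scale_bounds c M) h / c"
    using value_set_nonempty[OF assms(1,2)] unfolding relearning_gap_def[of M]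
    by (intro cSUP_least) auto
  then show ?thesis using \<open>0 < c\<close> by (simp add: field_simps)
qed

text \<open>With all reward bounds \<open>0\<close>, the bound on the losses is \<open>0\<close> too.\<close>

lemma relearning_gap_zero_bounds:
  assumes "h \<in> histories M t" "t \<le> horizon M"
  shows "relearning_gap (scale_bounds 0 M) h = 0"
proof -
  interpret zero: event_tree "scale_bounds 0 M"
    by (simp add: event_tree_scale_bounds)
  have node: "h \<in> histories (scale_bounds 0 M) t" "t \<le> horizon (scale_bounds 0 M)"
    using assms by simp_all
  have "(\<lambda>(p, u). p - u ! 0) ` value_set (scale_bounds 0 M) h = {0}"
    using zero.value_set_losses[OF node] zero.value_set_nonempty[OF node]
    by (simp add: value_bound_scale_bounds subset_singleton_iff)
  then show ?thesis by (simp add: relearning_gap_def)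
qed

text \<open>For \<open>c > 0\<close> the reverse inequality is \<open>relearning_gap_scale_bounds_ge\<close> for the scaled model and
  the factor \<open>inverse c\<close>, which restores the original bounds.\<close>

lemma relearning_gap_scale_bounds:
  assumes "h \<in> histories M t" "t \<le> horizon M" "0 \<le> c"
  shows "relearning_gap (scale_bounds c M) h = c * relearning_gap M h"
proof (cases "c = 0")
  case True
  then show ?thesis using relearning_gap_zero_bounds assms by simp
next
  case False
  interpret scaled: event_tree "scale_bounds c M"
    using assms by (simp add: event_tree_scale_bounds)
  have "inverse c * relearning_gap (scale_bounds c M) h \<le> relearning_gap M h"
    using scaled.relearning_gap_scale_bounds_ge[of h t "inverse c"] False assms
    by (simp add: scale_bounds_inverse)
  then have "relearning_gap (scale_bounds c M) h \<le> c * relearning_gap M h"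
    using False assms by (simp add: field_simps)
  then show ?thesis
    using relearning_gap_scale_bounds_ge[of h t c] False assms by simp
qed

end

theorem theorem7p2:
  fixes M :: "('o, 'a, 'y) event_model"
    and t :: nat
    and h :: "('o, 'a, 'y) history"
  assumes "event_tree M"
    and "t \<le> horizon M"
    and "h \<in> histories M t"
  shows "value_set M h =
      {(precommit M r h, map (\<lambda>s. V M r \<pi> s h) [0..<Suc t]) | r \<pi>.
        r \<in> reward_systems M h \<and> \<pi> \<in> SPE M r h}
    \<and> relearning_gap M h =
      (SUP r\<in>reward_systems M h. SUP \<pi>\<in>SPE M r h. precommit M r h - V M r \<pi> 0 h)
    \<and> (relearning_gap M h = 0 \<longleftrightarrow>
      (\<forall>r\<in>reward_systems M h. \<forall>\<pi>\<in>SPE M r h. precommit M r h - V M r \<pi> 0 h = 0))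
    \<and> (\<forall>c::real. c \<ge> 0 \<longrightarrow> relearning_gap (scale_bounds c M) h = c * relearning_gap M h)"
proof -
  interpret event_tree M by fact
  note node = assms(3,2)
  \<comment> \<open>All pairs of a reward system and an equilibrium for it; both forms of the gap are suprema
    of the loss over this set, one of them taken in two stages.\<close>
  let ?E = "\<Union>r\<in>reward_systems M h. Pair r ` SPE M r h"
  let ?loss = "\<lambda>(r, \<pi>). precommit M r h - V M r \<pi> 0 h"
  have char: "value_set M h =
      {(precommit M r h, map (\<lambda>s. V M r \<pi> s h) [0..<Suc t]) | r \<pi>.
        r \<in> reward_systems M h \<and> \<pi> \<in> SPE M r h}"
    using node by (rule value_set_eq)
  have "value_set M h = (\<lambda>(r, \<pi>). (precommit M r h, map (\<lambda>s. V M r \<pi> s h) [0..<Suc t])) ` ?E"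
    unfolding char image_UN image_image by (auto simp del: upt_Suc)
  then have losses: "(\<lambda>(p, u). p - u ! 0) ` value_set M h = ?loss ` ?E"
    by (simp add: image_image case_prod_unfold del: upt_Suc)
  have gap: "relearning_gap M h = (SUP e\<in>?E. ?loss e)"
    unfolding relearning_gap_def losses ..
  have bdd: "bdd_above (?loss ` ?E)"
    using bdd_above_losses[OF node] unfolding losses .
  have "?loss ` ?E \<subseteq> {0..2 * value_bound M (hdate h)}"
    using value_set_losses[OF node] unfolding losses .
  then have nonneg: "0 \<le> ?loss e" if "e \<in> ?E" for e
    using imageI[OF that, of ?loss] by (meson atLeastAtMost_iff subsetD)
  have nonempty: "?E \<noteq> {}"
    by (simp add: reward_systems_nonempty SPE_nonempty[OF node])
  have "(SUP e\<in>?E. ?loss e) = (SUP r\<in>reward_systems M h. SUP e\<in>Pair r ` SPE M r h. ?loss e)"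
  proof (rule cSUP_UNION)
    show "reward_systems M h \<noteq> {}" by (rule reward_systems_nonempty)
    show "Pair r ` SPE M r h \<noteq> {}" for r using SPE_nonempty[OF node] by simp
    show "bdd_above (\<Union>r\<in>reward_systems M h. ?loss ` Pair r ` SPE M r h)"
      using bdd unfolding image_UN .
  qed
  then have nested: "relearning_gap M h =
      (SUP r\<in>reward_systems M h. SUP \<pi>\<in>SPE M r h. precommit M r h - V M r \<pi> 0 h)"
    unfolding gap by (simp add: image_image)
  have "relearning_gap M h = 0 \<longleftrightarrow> (\<forall>e\<in>?E. ?loss e = 0)"
  proof
    assume "relearning_gap M h = 0"
    then have "?loss e \<le> 0" if "e \<in> ?E" for e
      using cSUP_upper[OF that bdd] unfolding gap by (rule ord_le_eq_trans[rotated])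
    then show "\<forall>e\<in>?E. ?loss e = 0"
      using nonneg by (intro ballI antisym)
  next
    assume "\<forall>e\<in>?E. ?loss e = 0"
    then have "(SUP e\<in>?E. ?loss e) = (SUP e\<in>?E. 0)" by (intro SUP_cong) auto
    then show "relearning_gap M h = 0" unfolding gap using nonempty by simp
  qed
  then have zero: "relearning_gap M h = 0 \<longleftrightarrow>
      (\<forall>r\<in>reward_systems M h. \<forall>\<pi>\<in>SPE M r h. precommit M r h - V M r \<pi> 0 h = 0)"
    by auto
  show ?thesis
    using char nested zero relearning_gap_scale_bounds[OF node] by blast
qed

end
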